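(* Let $\boldsymbol\tau=(\tau_1,\dots,\tau_{\mathsf{t}_{\max}})$ be a probability vector with mean $\bar{\mathsf{t}}=\sum_{\mathsf{t}=1}^{\mathsf{t}_{\max}}\tau_{\mathsf{t}}\,\mathsf{t}$ and let $c>0$. If decoding of the irregular half-product code with distribution $\boldsymbol\tau$ is asymptotically successful at effective channel quality $c$, i.e., if $\lim_{\ell\to\infty}x^{(\ell)}=0$ for the density evolution recursion $x^{(0)}=1$, $x^{(\ell)}=\sum_{\mathsf{t}=1}^{\mathsf{t}_{\max}}\tau_{\mathsf{t}}\Psi_{\ge\mathsf{t}}(c\,x^{(\ell-1)})$, then $$c\le 2\bar{\mathsf{t}}-2\mathcal{L}_{\boldsymbol\tau}(c).$$
   Context: Notation: $\Psi_{=i}(\lambda)=\frac{\lambda^i}{i!}e^{-\lambda}$ and $\Psi_{\ge s}(\lambda)=1-\sum_{i=0}^{s-1}\Psi_{=i}(\lambda)$ (Poisson tail probability with mean $\lambda$). Here $\tau_{\mathsf{t}}$ is the fraction of component codes that correct $\mathsf{t}$ erasures. The initial component code loss of $\boldsymbol\tau$ is $$\mathcal{L}_{\boldsymbol\tau}(c)=\sum_{\mathsf{t}=1}^{\mathsf{t}_{\max}}\tau_{\mathsf{t}}\,\mathcal{L}(\mathsf{t},c),\qquad \mathcal{L}(\mathsf{t},c)=\sum_{i=0}^{\mathsf{t}-1}\Psi_{=i}(c)(\mathsf{t}-i).$$ *)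

theory Defs
  imports Complex_Main
begin

definition poisson_eq :: "nat \<Rightarrow> real \<Rightarrow> real" where
  "poisson_eq i \<mu> = \<mu> ^ i / fact i * exp (- \<mu>)"

definition poisson_tail :: "nat \<Rightarrow> real \<Rightarrow> real" where
  "poisson_tail s \<mu> = 1 - (\<Sum>i<s. poisson_eq i \<mu>)"

text \<open>
  A vector \<open>(\<tau>\<^sub>1, \<dots>, \<tau>\<^sub>m)\<close> is represented by a function on the naturals together
  with its length \<open>m\<close>; only the values at the indices \<open>1, \<dots>, m\<close> are used.
\<close>

definition prob_vector :: "nat \<Rightarrow> (nat \<Rightarrow> real) \<Rightarrow> bool" where
  "prob_vector m \<tau> \<longleftrightarrow> (\<forall>t\<in>{1..m}. 0 \<le> \<tau> t) \<and> (\<Sum>t=1..m. \<tau> t) = 1"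

definition mean_capability :: "nat \<Rightarrow> (nat \<Rightarrow> real) \<Rightarrow> real" where
  "mean_capability m \<tau> = (\<Sum>t=1..m. \<tau> t * real t)"

definition code_loss :: "nat \<Rightarrow> real \<Rightarrow> real" where
  "code_loss t c = (\<Sum>i<t. poisson_eq i c * (real t - real i))"

definition initial_loss :: "nat \<Rightarrow> (nat \<Rightarrow> real) \<Rightarrow> real \<Rightarrow> real" where
  "initial_loss m \<tau> c = (\<Sum>t=1..m. \<tau> t * code_loss t c)"

primrec density_evolution :: "nat \<Rightarrow> (nat \<Rightarrow> real) \<Rightarrow> real \<Rightarrow> nat \<Rightarrow> real" where
  "density_evolution m \<tau> c 0 = 1"
| "density_evolution m \<tau> c (Suc l) =
     (\<Sum>t=1..m. \<tau> t * poisson_tail t (c * density_evolution m \<tau> c l))"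

definition decoding_successful :: "nat \<Rightarrow> (nat \<Rightarrow> real) \<Rightarrow> real \<Rightarrow> bool" where
  "decoding_successful m \<tau> c \<longleftrightarrow> density_evolution m \<tau> c \<longlonglongrightarrow> 0"

end

(*
  Write F for the map iterated by density evolution. As F is increasing, its iterates
  from 1 can tend to 0 only if F(x) \<le> x on (0, 1]. The theorem is this inequality
  integrated over [0, 1]: since L(t, \<cdot>) has derivative \<Psi>_{\<ge>t} - 1 and L(t, 0) = t,
  the integral of F is 1 - (tbar - L_\<tau>(c)) / c, which is therefore at most 1/2.
*)

theory Submission
  imports Defs
begin

text \<open>Each further term \<open>poisson_eq (Suc t)\<close> has derivative
  \<open>poisson_eq t\<close> minus itself, so the derivative of the sum telescopes. The index is a
  successor because \<open>poisson_tail 0\<close> is constant.\<close>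

lemma poisson_tail_Suc_has_derivative:
  "(poisson_tail (Suc t) has_real_derivative poisson_eq t \<mu>) (at \<mu>)"
proof (induction t)
  case 0
  have "poisson_tail (Suc 0) = (\<lambda>\<mu>. 1 - exp (- \<mu>))"
    by (simp add: fun_eq_iff poisson_tail_def poisson_eq_def)
  then show ?case
    by (auto simp: poisson_eq_def intro!: derivative_eq_intros)
next
  case (Suc t)
  have "poisson_tail (Suc (Suc t)) = (\<lambda>\<mu>. poisson_tail (Suc t) \<mu> - poisson_eq (Suc t) \<mu>)"
    by (simp add: fun_eq_iff poisson_tail_def)
  moreover have "(poisson_eq (Suc t) has_real_derivative
      poisson_eq t \<mu> - poisson_eq (Suc t) \<mu>) (at \<mu>)"
    unfolding poisson_eq_def
    by (auto intro!: derivative_eq_intros simp: divide_simps simp del: of_nat_Suc)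
      (cases t; simp add: algebra_simps)
  ultimately show ?case
    using DERIV_diff[OF Suc.IH] by fastforce
qed

lemma poisson_tail_mono:
  assumes "0 \<le> \<mu>" "\<mu> \<le> \<nu>"
  shows "poisson_tail t \<mu> \<le> poisson_tail t \<nu>"
proof (cases t)
  case 0
  then show ?thesis by (simp add: poisson_tail_def)
next
  case (Suc s)
  have nonneg: "0 \<le> poisson_eq s x" if "\<mu> \<le> x" for x
    using that assms by (simp add: poisson_eq_def)
  show ?thesis
    unfolding Suc
    by (rule DERIV_nonneg_imp_nondecreasing[OF assms(2)])
      (use nonneg poisson_tail_Suc_has_derivative in blast)
qed

text \<open>Raising \<open>t\<close> by one raises every weight by one, which adds the Poisson mass
  on \<open>0..t\<close>; the new index \<open>i = t\<close> had weight 0 before.\<close>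

lemma code_loss_Suc: "code_loss (Suc t) \<mu> = code_loss t \<mu> + (1 - poisson_tail (Suc t) \<mu>)"
proof -
  have "code_loss (Suc t) \<mu> = (\<Sum>i<Suc t. poisson_eq i \<mu> * (real t - real i) + poisson_eq i \<mu>)"
    unfolding code_loss_def by (intro sum.cong) (auto simp: algebra_simps)
  also have "\<dots> = code_loss t \<mu> + (1 - poisson_tail (Suc t) \<mu>)"
    by (simp add: sum.distrib code_loss_def poisson_tail_def)
  finally show ?thesis .
qed

lemma code_loss_has_derivative:
  "(code_loss t has_real_derivative poisson_tail t \<mu> - 1) (at \<mu>)"
proof (induction t)
  case 0
  then show ?case by (simp add: code_loss_def[abs_def] poisson_tail_def)
next
  case (Suc t)
  have "code_loss (Suc t) = (\<lambda>\<mu>. code_loss t \<mu> + (1 - poisson_tail (Suc t) \<mu>))"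
    by (simp add: fun_eq_iff code_loss_Suc)
  moreover have "poisson_tail (Suc t) \<mu> = poisson_tail t \<mu> - poisson_eq t \<mu>"
    by (simp add: poisson_tail_def)
  ultimately show ?case
    using Suc.IH
    by (auto intro!: derivative_eq_intros poisson_tail_Suc_has_derivative)
qed

lemma code_loss_0: "code_loss t 0 = real t"
proof (induction t)
  case 0
  then show ?case by (simp add: code_loss_def)
next
  case (Suc t)
  have "poisson_tail (Suc t) 0 = 0"
    \<comment> \<open>At mean 0 all mass sits at \<open>i = 0\<close>, where
      \<open>0 ^ 0 = 1\<close>; hence this term is split off.\<close>
    unfolding poisson_tail_def sum.lessThan_Suc_shift by (simp add: poisson_eq_def)
  with Suc.IH show ?case by (simp add: code_loss_Suc)
qed

text \<open>If the map sent \<open>y\<close> above \<open>y\<close>, monotonicity would keep every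
  iterate from 1 at or above \<open>y\<close>, and the limit could not be 0.\<close>

lemma density_evolution_map_le:
  assumes "prob_vector m \<tau>" "c > 0" "decoding_successful m \<tau> c" "0 < y" "y \<le> 1"
  shows "(\<Sum>t=1..m. \<tau> t * poisson_tail t (c * y)) \<le> y"
proof (rule ccontr)
  assume less: "\<not> ?thesis"
  have "y \<le> density_evolution m \<tau> c l" for l
  proof (induction l)
    case 0
    then show ?case using assms by simp
  next
    case (Suc l)
    have "(\<Sum>t=1..m. \<tau> t * poisson_tail t (c * y)) \<le> density_evolution m \<tau> c (Suc l)"
      unfolding density_evolution.simps using assms Suc.IH
      by (intro sum_mono mult_left_mono poisson_tail_mono) (auto simp: prob_vector_def)
    then show ?case using less by linarith
  qed
  then have "y \<le> 0"
    using LIMSEQ_le_const[OF assms(3)[unfolded decoding_successful_def]] by simp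
  then show False using assms(4) by simp
qed

theorem mainTheorem5:
  fixes tmax :: nat and \<tau> :: "nat \<Rightarrow> real" and c :: real
  assumes "prob_vector tmax \<tau>"
    and "c > 0"
    and "decoding_successful tmax \<tau> c"
  shows "c \<le> 2 * mean_capability tmax \<tau> - 2 * initial_loss tmax \<tau> c"
proof -
  \<comment> \<open>Here \<mu> stands for \<open>c * x\<close>, so the density evolution map is
    \<open>F (c * x)\<close> and integration runs over \<open>{0..c}\<close>.\<close>
  define F where "F \<mu> = (\<Sum>t=1..tmax. \<tau> t * poisson_tail t \<mu>)" for \<mu>
  \<comment> \<open>An antiderivative of \<open>F \<mu> - \<mu> / c\<close>, which replaces the
    integral by a monotonicity argument.\<close>
  define H where "H \<mu> = initial_loss tmax \<tau> \<mu> + \<mu> - \<mu>\<^sup>2 / (2 * c)" for \<mu>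
  have loss: "(initial_loss tmax \<tau> has_real_derivative F \<mu> - 1) (at \<mu>)" for \<mu>
  proof -
    have "(initial_loss tmax \<tau> has_real_derivative
        (\<Sum>t=1..tmax. \<tau> t * (poisson_tail t \<mu> - 1))) (at \<mu>)"
      unfolding initial_loss_def
      by (intro DERIV_sum DERIV_cmult code_loss_has_derivative)
    also have "(\<Sum>t=1..tmax. \<tau> t * (poisson_tail t \<mu> - 1)) = F \<mu> - 1"
      using assms(1) by (simp add: F_def prob_vector_def right_diff_distrib sum_subtractf)
    finally show ?thesis .
  qed
  have deriv: "(H has_real_derivative F \<mu> - \<mu> / c) (at \<mu>)" for \<mu>
    unfolding H_def using assms(2)
    by (auto intro!: derivative_eq_intros loss simp: field_simps)
  have nonpos: "F \<mu> - \<mu> / c \<le> 0" if "0 < \<mu>" "\<mu> < c" for \<mu>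
    using density_evolution_map_le[OF assms, of "\<mu> / c"] that assms(2) by (simp add: F_def)
  have "H c \<le> H 0"
  proof (rule DERIV_nonpos_imp_decreasing_open[where f = H])
    show "0 \<le> c"
      using assms(2) by simp
    show "\<exists>y. (H has_real_derivative y) (at \<mu>) \<and> y \<le> 0" if "0 < \<mu>" "\<mu> < c" for \<mu>
      using deriv nonpos[OF that] by blast
    show "continuous_on {0..c} H"
      by (rule DERIV_continuous_on) (rule has_field_derivative_at_within[OF deriv])
  qed
  \<comment> \<open>\<open>H 0\<close> is the mean capability, and \<open>H c\<close> is the initial
    loss at \<open>c\<close> plus \<open>c / 2\<close>.\<close>
  then show ?thesis
    using assms(2)
    by (simp add: H_def power2_eq_square initial_loss_def mean_capability_def code_loss_0)
qed

end
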